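(* Let $\lambda>0$ and let $G$ be the Green's function of $\Gamma_d(\lambda)$. (a) If $d\in\{1,2\}$, then $\sum_{z\in\mathbb{Z}^{d+1}}G(0,z)^2=\infty$. (b) If $d\ge3$, then $\sum_{z\in\mathbb{Z}^{d+1}}G(0,z)^2<\infty$.
   Context: $\Gamma_d(\lambda)$ is the nearest-neighbour lattice graph on $\mathbb{Z}^{d+1}=\mathbb{Z}\times\mathbb{Z}^d$ with conductance $\mu((n,x),(n',x'))=e^{\lambda\max(n,n')}$ on each edge $(n,x)\sim(n',x')$. The network random walk $(S_m)_{m\ge 0}$ is the Markov chain which jumps to a neighbour with probability proportional to the conductance of the connecting edge; equivalently, its i.i.d. steps equal $(1,0)$ with probability $e^\lambda/(2d+1+e^\lambda)$ and each of the other $2d+1$ signed unit vectors with probability $1/(2d+1+e^\lambda)$. The Green's function is $G(z,z')=\sum_{m\ge 0}\mathbb{P}(S_m=z'\mid S_0=z)$. *)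

theory Defs
  imports "HOL-Probability.Probability"
begin

text \<open>
  Sites \<open>(n, x)\<close> of \<open>\<int> \<times> \<int>\<^sup>d\<close>, where \<open>d\<close> is \<open>CARD('d)\<close>.
\<close>

type_synonym 'd site = "int \<times> (int ^ 'd)"

definition adjacent :: "'d::finite site \<Rightarrow> 'd site \<Rightarrow> bool" where
  "adjacent z w \<longleftrightarrow> \<bar>fst z - fst w\<bar> + (\<Sum>i\<in>UNIV. \<bar>snd z $ i - snd w $ i\<bar>) = 1"

definition conductance :: "real \<Rightarrow> 'd::finite site \<Rightarrow> 'd site \<Rightarrow> real" where
  "conductance lam z w =
     (if adjacent z w then exp (lam * real_of_int (max (fst z) (fst w))) else 0)"

definition step_prob :: "real \<Rightarrow> 'd::finite site \<Rightarrow> 'd site \<Rightarrow> real" where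
  "step_prob lam z w = conductance lam z w / (\<Sum>v | adjacent z v. conductance lam z v)"

text \<open>The use of \<open>embed_pmf\<close> is justified by \<open>pmf_network_step\<close> below.\<close>

definition network_step :: "real \<Rightarrow> 'd::finite site \<Rightarrow> 'd site pmf" where
  "network_step lam z = embed_pmf (step_prob lam z)"

text \<open>\<open>network_walk lam z m\<close> is the law of \<open>S\<^sub>m\<close> given \<open>S\<^sub>0 = z\<close>.\<close>

primrec network_walk :: "real \<Rightarrow> 'd::finite site \<Rightarrow> nat \<Rightarrow> 'd site pmf" where
  "network_walk lam z 0 = return_pmf z"
| "network_walk lam z (Suc m) = bind_pmf (network_walk lam z m) (network_step lam)"

definition green :: "real \<Rightarrow> 'd::finite site \<Rightarrow> 'd site \<Rightarrow> ennreal" where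
  "green lam z w = (\<Sum>m. ennreal (pmf (network_walk lam z m) w))"

lemma finite_adjacent: "finite {w. adjacent (z :: 'd::finite site) w}"
proof -
  let ?B = "{fst z - 1..fst z + 1} \<times>
    (vec_lambda ` (PiE UNIV (\<lambda>i. {snd z $ i - 1..snd z $ i + 1})))"
  have *: "w \<in> ?B" if w: "adjacent z w" for w
  proof -
    have s: "(\<Sum>i\<in>UNIV. \<bar>snd z $ i - snd w $ i\<bar>) \<ge> 0"
      by (intro sum_nonneg) auto
    have i: "\<bar>snd z $ i - snd w $ i\<bar> \<le> (\<Sum>i\<in>UNIV. \<bar>snd z $ i - snd w $ i\<bar>)" for i
      by (rule member_le_sum) auto
    have 1: "\<bar>fst z - fst w\<bar> \<le> 1"
      using w s unfolding adjacent_def by linarith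
    have 2: "\<bar>snd z $ i - snd w $ i\<bar> \<le> 1" for i
      using w i[of i] unfolding adjacent_def by linarith
    have "snd w = vec_lambda (\<lambda>i. snd w $ i)" by simp
    moreover have "(\<lambda>i. snd w $ i) \<in> PiE UNIV (\<lambda>i. {snd z $ i - 1..snd z $ i + 1})"
    proof (rule PiE_I)
      fix i :: 'd
      show "snd w $ i \<in> {snd z $ i - 1..snd z $ i + 1}"
        using 2[of i] by (simp add: abs_le_iff)
    qed simp
    ultimately have "snd w \<in> vec_lambda ` (PiE UNIV (\<lambda>i. {snd z $ i - 1..snd z $ i + 1}))"
      by (rule image_eqI)
    with 1 show ?thesis by (cases w) auto
  qed
  have "finite ?B" by (intro finite_cartesian_product finite_imageI finite_PiE) auto
  moreover have "{w. adjacent z w} \<subseteq> ?B"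
    by (rule subsetI, rule *, erule CollectD)
  ultimately show ?thesis by (rule rev_finite_subset)
qed

lemma adjacent_sum_pos: "(\<Sum>v | adjacent z v. conductance lam z v) > 0"
proof (rule sum_pos2)
  show "finite {v. adjacent z v}" by (rule finite_adjacent)
  show "(fst z + 1, snd z) \<in> {v. adjacent z v}" by (simp add: adjacent_def)
  show "0 < conductance lam z (fst z + 1, snd z)"
    by (simp add: conductance_def adjacent_def)
qed (simp add: conductance_def)

lemma pmf_network_step: "pmf (network_step lam z) w = step_prob lam z w"
  unfolding network_step_def
proof (rule pmf_embed_pmf)
  show nn: "step_prob lam z w \<ge> 0" for w
    using adjacent_sum_pos[where z = z and lam = lam]
    by (auto simp: step_prob_def conductance_def)
  have "(\<integral>\<^sup>+w. ennreal (step_prob lam z w) \<partial>count_space UNIV)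
      = (\<integral>\<^sup>+w. ennreal (step_prob lam z w) \<partial>count_space {w. adjacent z w})"
    by (rule nn_integral_count_space_eq) (simp_all add: step_prob_def conductance_def)
  also have "\<dots> = ennreal (\<Sum>w | adjacent z w. step_prob lam z w)"
    by (subst nn_integral_count_space_finite[OF finite_adjacent]) (rule sum_ennreal, rule nn)
  also have "(\<Sum>w | adjacent z w. step_prob lam z w) = 1"
    using adjacent_sum_pos[where z = z and lam = lam]
    by (simp add: step_prob_def flip: sum_divide_distrib)
  finally show "(\<integral>\<^sup>+w. ennreal (step_prob lam z w) \<partial>count_space UNIV) = 1"
    by (simp only: ennreal_1)
qed

end

theory Submission
  imports Defs
begin

text \<open>
  Let \<open>G\<close> be the Green's function from the origin and \<open>\<phi>\<close> the characteristic function of a step, on the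
  torus of frequencies \<open>(s, \<theta>)\<close>. By Parseval, \<open>(2\<pi>)\<^bsup>d+1\<^esup> \<Sum> G\<^sup>2\<close> is at most the
  supremum over \<open>M\<close> of \<open>\<integral> \<bar>1 - \<phi>\<^sup>M\<bar>\<^sup>2 / \<bar>1 - \<phi>\<bar>\<^sup>2\<close>. The drift makes the imaginary part of \<open>1 - \<phi>\<close> of
  order \<open>s\<close>, so \<open>\<bar>1 - \<phi>\<bar>\<^sup>2\<close> dominates \<open>Q = s\<^sup>2 + \<Sum> \<theta>\<^sub>i\<^sup>4\<close>. With three horizontal frequencies,
  \<open>1/Q\<close> is at most the product of the \<open>-4/5\<close> powers of \<open>\<bar>s\<bar>\<close> and the three \<open>\<bar>\<theta>\<^sub>i\<bar>\<close> (the exponents add up as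
  \<open>2/5 + 3 \<cdot> 1/5 = 1\<close>), which is integrable.

  For \<open>d \<le> 2\<close>, put \<open>N = 4\<^sup>k\<close>. At a time in \<open>[N, 2N)\<close> the walk is, with probability at least one
  half, in a box of height of order \<open>N\<close> and width of order \<open>\<surd>N\<close>, which has \<open>O(N\<^sup>2)\<close> sites. By
  Cauchy-Schwarz the visits in this time window contribute at least a constant to \<open>\<Sum> G\<^sup>2\<close>, and
  since squares are superadditive the contributions of different \<open>k\<close> add up.
\<close>

section \<open>One step of the walk\<close>

definition hstep :: "'d::finite site \<Rightarrow> 'd \<Rightarrow> int \<Rightarrow> 'd site" where
  "hstep z i s = (fst z, snd z + axis i s)"

text \<open>Integer differences whose absolute values add up to 1 leave room for only one nonzero
  difference, which is 1 or -1.\<close>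

lemma adjacent_cases:
  fixes z w :: "'d::finite site"
  assumes "adjacent z w"
  obtains "w = (fst z + 1, snd z)" | "w = (fst z - 1, snd z)"
    | i where "w = hstep z i 1" | i where "w = hstep z i (-1)"
proof -
  obtain n x where z: "z = (n, x)" by (cases z)
  obtain m y where w: "w = (m, y)" by (cases w)
  have eq: "\<bar>n - m\<bar> + (\<Sum>i\<in>UNIV. \<bar>x $ i - y $ i\<bar>) = 1"
    using assms by (simp add: adjacent_def z w)
  show thesis
  proof (cases "x = y")
    case True
    then have "\<bar>n - m\<bar> = 1" using eq by simp
    then have "m = n + 1 \<or> m = n - 1" by linarith
    then show thesis using that True z w by auto
  next
    case False
    then obtain i where i: "x $ i \<noteq> y $ i" by (auto simp: vec_eq_iff)
    have s: "(\<Sum>j\<in>UNIV. \<bar>x $ j - y $ j\<bar>) = \<bar>x $ i - y $ i\<bar> + (\<Sum>j\<in>UNIV - {i}. \<bar>x $ j - y $ j\<bar>)"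
      by (rule sum.remove) auto
    have nn: "(\<Sum>j\<in>UNIV - {i}. \<bar>x $ j - y $ j\<bar>) \<ge> 0" by (intro sum_nonneg) auto
    have "n = m" "\<bar>x $ i - y $ i\<bar> = 1" and z0: "(\<Sum>j\<in>UNIV - {i}. \<bar>x $ j - y $ j\<bar>) = 0"
      using eq s nn i by linarith+
    have "y $ j = x $ j" if "j \<noteq> i" for j
      using z0 that by (subst (asm) sum_nonneg_eq_0_iff) auto
    moreover have "y $ i = x $ i + 1 \<or> y $ i = x $ i - 1"
      using \<open>\<bar>x $ i - y $ i\<bar> = 1\<close> by linarith
    ultimately have "y = x + axis i 1 \<or> y = x + axis i (-1)"
      by (auto simp: vec_eq_iff axis_def)
    then show thesis using that z w \<open>n = m\<close> by (auto simp: hstep_def)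
  qed
qed

lemma adjacent_vertical: "adjacent z (fst z + 1, snd z)" "adjacent z (fst z - 1, snd z)"
  by (auto simp: adjacent_def)

lemma adjacent_hstep: "\<bar>s\<bar> = 1 \<Longrightarrow> adjacent z (hstep z i s)"
  by (simp add: adjacent_def hstep_def axis_def if_distrib[of abs] cong: if_cong)

lemma sum_adjacent:
  fixes f :: "'d::finite site \<Rightarrow> 'a::comm_monoid_add"
  shows "(\<Sum>w | adjacent z w. f w) = f (fst z + 1, snd z) + (f (fst z - 1, snd z)
    + (\<Sum>i\<in>UNIV. f (hstep z i 1) + f (hstep z i (-1))))"
proof -
  let ?u = "(fst z + 1, snd z)" and ?v = "(fst z - 1, snd z)"
  let ?S = "\<lambda>s. range (\<lambda>i. hstep z i s)"
  have "{w. adjacent z w} = insert ?u (insert ?v (?S 1 \<union> ?S (-1)))"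
    by (auto elim!: adjacent_cases simp: adjacent_vertical adjacent_hstep simp del: prod.collapse)
  moreover have "?u \<notin> insert ?v (?S 1 \<union> ?S (-1))" "?v \<notin> ?S 1 \<union> ?S (-1)"
    by (auto simp: hstep_def)
  moreover have "?S 1 \<inter> ?S (-1) = {}"
    by (auto simp: hstep_def axis_eq_axis)
  moreover have "inj (\<lambda>i. hstep z i s)" if "s \<noteq> 0" for s
    using that by (auto simp: inj_def hstep_def axis_eq_axis)
  then have "(\<Sum>w\<in>?S s. f w) = (\<Sum>i\<in>UNIV. f (hstep z i s))" if "s \<noteq> 0" for s
    using that by (simp add: sum.reindex)
  ultimately show ?thesis
    by (simp add: sum.union_disjoint sum.distrib)
qed

text \<open>Every edge at \<open>z\<close> has conductance \<open>exp (lam * fst z)\<close>, except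
  the upward one, which has an extra factor \<open>exp lam\<close>. The height factor cancels, so
  the increments do not depend on \<open>z\<close>. Vector values let the formula serve both the
  real \<open>sqn\<close> and the complex \<open>site_char\<close>.\<close>

lemma expectation_network_step:
  fixes f :: "'d::finite site \<Rightarrow> 'a::{banach, second_countable_topology}"
  shows "measure_pmf.expectation (network_step lam z) f
    = (exp lam *\<^sub>R f (fst z + 1, snd z) + (f (fst z - 1, snd z)
        + (\<Sum>i\<in>UNIV. f (hstep z i 1) + f (hstep z i (-1)))))
       /\<^sub>R (exp lam + 1 + 2 * real CARD('d))"
proof -
  have c: "conductance lam z (fst z + 1, snd z) = exp (lam * fst z) * exp lam"
    "conductance lam z (fst z - 1, snd z) = exp (lam * fst z)"
    by (simp_all add: conductance_def adjacent_def distrib_left exp_add)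
  have c': "conductance lam z (hstep z i s) = exp (lam * fst z)" if "\<bar>s\<bar> = 1" for i s
    using adjacent_hstep[OF that, of z i] by (simp add: conductance_def hstep_def)
  have D: "(\<Sum>v | adjacent z v. conductance lam z v) = exp (lam * fst z) * (exp lam + 1 + 2 * real CARD('d))"
    by (simp add: sum_adjacent c c' distrib_left)
  have pos: "exp lam + 1 + 2 * real CARD('d) > 0"
    by (simp add: add_pos_nonneg)
  have "measure_pmf.expectation (network_step lam z) f
      = (\<Sum>w | adjacent z w. pmf (network_step lam z) w *\<^sub>R f w)"
    by (intro integral_measure_pmf finite_adjacent)
       (auto simp: set_pmf_eq pmf_network_step step_prob_def conductance_def split: if_splits)
  also have "\<dots> = (\<Sum>w | adjacent z w. conductance lam z w *\<^sub>R f w)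
     /\<^sub>R (exp (lam * fst z) * (exp lam + 1 + 2 * real CARD('d)))"
    by (simp add: pmf_network_step step_prob_def D scaleR_sum_right divide_inverse mult.commute)
  also have "(\<Sum>w | adjacent z w. conductance lam z w *\<^sub>R f w) = exp (lam * fst z) *\<^sub>R
     (exp lam *\<^sub>R f (fst z + 1, snd z) + (f (fst z - 1, snd z)
        + (\<Sum>i\<in>UNIV. f (hstep z i 1) + f (hstep z i (-1)))))"
    by (simp add: sum_adjacent c c' scaleR_add_right scaleR_sum_right)
  finally show ?thesis using pos by (simp add: inverse_mult_distrib)
qed

lemma finite_set_pmf_network_step: "finite (set_pmf (network_step lam z))"
  by (rule finite_subset[OF _ finite_adjacent[of z]])
     (auto simp: set_pmf_eq pmf_network_step step_prob_def conductance_def split: if_splits)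

lemma finite_set_pmf_network_walk: "finite (set_pmf (network_walk lam z m))"
  by (induction m) (auto simp: finite_set_pmf_network_step)

text \<open>Conditioning on the position before the last step; finite supports replace any
  integrability hypothesis on \<open>f\<close>.\<close>

lemma expectation_network_walk_Suc:
  fixes f :: "'d::finite site \<Rightarrow> 'a::{banach, second_countable_topology}"
  shows "measure_pmf.expectation (network_walk lam z (Suc m)) f
    = measure_pmf.expectation (network_walk lam z m)
        (\<lambda>w. measure_pmf.expectation (network_step lam w) f)"
proof -
  note fin = finite_set_pmf_network_walk[of lam z m]
  show ?thesis
    using pmf_expectation_bind[OF fin finite_set_pmf_network_step subset_refl, where h = f]
      integral_measure_pmf[OF fin, where f = "\<lambda>w. measure_pmf.expectation (network_step lam w) f"]
    by simp
qed

lemma integrable_network_walk [simp]: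
  fixes f :: "'d::finite site \<Rightarrow> 'a::{banach, second_countable_topology}"
  shows "integrable (measure_pmf (network_walk lam z m)) f"
  by (rule integrable_measure_pmf_finite[OF finite_set_pmf_network_walk])

section \<open>Horizontal second moment\<close>

lemma abs_fst_network_walk:
  "w \<in> set_pmf (network_walk lam 0 m) \<Longrightarrow> \<bar>fst w\<bar> \<le> int m"
proof (induction m arbitrary: w)
  case (Suc m)
  then obtain v where v: "v \<in> set_pmf (network_walk lam 0 m)" "adjacent v w"
    by (auto simp: set_pmf_eq[of "network_step _ _"] pmf_network_step step_prob_def conductance_def split: if_splits)
  have "(\<Sum>i\<in>UNIV. \<bar>snd v $ i - snd w $ i\<bar>) \<ge> 0"
    by (intro sum_nonneg) auto
  then show ?case using v(2) Suc.IH[OF v(1)] unfolding adjacent_def of_nat_Suc by linarith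
qed simp

definition sqn :: "'d::finite site \<Rightarrow> real" where
  "sqn z = (\<Sum>i\<in>UNIV. (real_of_int (snd z $ i))\<^sup>2)"

lemma sqn_hstep: "sqn (hstep z i s) = sqn z + 2 * real_of_int s * snd z $ i + (real_of_int s)\<^sup>2"
proof -
  have "(real_of_int ((snd z + axis i s) $ j))\<^sup>2 = (real_of_int (snd z $ j))\<^sup>2
     + (if j = i then 2 * real_of_int s * snd z $ i + (real_of_int s)\<^sup>2 else 0)" for j
    by (auto simp: axis_def power2_eq_square algebra_simps)
  then show ?thesis by (simp add: sqn_def hstep_def sum.distrib)
qed

text \<open>The cross terms of \<open>sqn_hstep\<close> cancel between the steps 1 and -1, so the
  mean increment is the probability of a horizontal step.\<close>

lemma expectation_sqn_step:
  "measure_pmf.expectation (network_step lam z) sqn \<le> sqn z + 1"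
proof -
  let ?D = "exp lam + 1 + 2 * real CARD('a)"
  have pos: "?D > 0" by (simp add: add_pos_nonneg)
  have "sqn (n, snd z) = sqn z" for n by (simp add: sqn_def)
  then have "measure_pmf.expectation (network_step lam z) sqn = (?D * sqn z + 2 * real CARD('a)) / ?D"
    by (simp add: expectation_network_step sqn_hstep field_simps)
  also have "\<dots> \<le> sqn z + 1" using pos by (simp add: field_simps add_nonneg_nonneg)
  finally show ?thesis .
qed

lemma expectation_sqn_walk:
  "measure_pmf.expectation (network_walk lam (0 :: 'd::finite site) m) sqn \<le> real m"
proof (induction m)
  case (Suc m)
  have "measure_pmf.expectation (network_walk lam (0 :: 'd site) (Suc m)) sqn
     \<le> measure_pmf.expectation (network_walk lam (0 :: 'd::finite site) m) (\<lambda>z. sqn z + 1)"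
    unfolding expectation_network_walk_Suc
    by (rule integral_mono) (simp_all add: expectation_sqn_step)
  also have "\<dots> = measure_pmf.expectation (network_walk lam (0 :: 'd::finite site) m) sqn + 1"
    by simp
  finally show ?case using Suc by simp
qed (simp add: sqn_def)

lemma prob_sqn_ge:
  fixes a :: real
  assumes "a > 0"
  shows "measure_pmf.prob (network_walk lam (0 :: 'd::finite site) m) {z. sqn z \<ge> a} \<le> real m / a"
proof -
  have "measure_pmf.prob (network_walk lam (0 :: 'd site) m) {z\<in>space (network_walk lam (0 :: 'd site) m). sqn z \<ge> a} \<le>
     measure_pmf.expectation (network_walk lam (0 :: 'd site) m) sqn / a"
    by (rule integral_Markov_inequality_measure[where A="{}"]) (auto simp: assms sqn_def intro!: sum_nonneg)
  also have "\<dots> \<le> real m / a" using assms by (intro divide_right_mono expectation_sqn_walk) simp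
  finally show ?thesis by simp
qed

text \<open>Serves both halves: it extracts the quartic terms from the real part of
  \<open>1 - step_char lam \<theta>\<close>, and it adds up the contributions of different time
  windows.\<close>

lemma sum_power2_le_power2_sum:
  fixes f :: "'a \<Rightarrow> 'b::linordered_idom"
  assumes "\<And>i. i \<in> S \<Longrightarrow> f i \<ge> 0"
  shows "(\<Sum>i\<in>S. (f i)\<^sup>2) \<le> (\<Sum>i\<in>S. f i)\<^sup>2"
  using assms
proof (induction S rule: infinite_finite_induct)
  case (insert i S)
  then have "(\<Sum>j\<in>S. (f j)\<^sup>2) \<le> (\<Sum>j\<in>S. f j)\<^sup>2" "0 \<le> f i * (\<Sum>j\<in>S. f j)"
    by (auto intro!: mult_nonneg_nonneg sum_nonneg)
  then show ?case using insert.hyps by (simp add: power2_sum)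
qed auto

section \<open>Characteristic function of a step\<close>

text \<open>The index type \<open>'d option\<close>, with \<open>None\<close> for the vertical
  direction, treats all d+1 coordinates uniformly, so that the torus is a single product
  measure.\<close>

definition coord :: "'d::finite site \<Rightarrow> 'd option \<Rightarrow> int" where
  "coord z j = (case j of None \<Rightarrow> fst z | Some i \<Rightarrow> snd z $ i)"

text \<open>The character of the lattice with frequency \<open>\<theta>\<close>, written as a
  product over coordinates so that its integrals factorise.\<close>

definition site_char :: "('d option \<Rightarrow> real) \<Rightarrow> 'd::finite site \<Rightarrow> complex" where
  "site_char \<theta> z = (\<Prod>j\<in>UNIV. cis (\<theta> j * coord z j))"

text \<open>Closed form of the characteristic function of one increment, as
  \<open>expectation_char_step\<close> confirms.\<close>

definition step_char :: "real \<Rightarrow> ('d::finite option \<Rightarrow> real) \<Rightarrow> complex" where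
  "step_char lam \<theta> =
     (exp lam *\<^sub>R cis (\<theta> None) + (cis (- \<theta> None) + of_real (\<Sum>i\<in>UNIV. 2 * cos (\<theta> (Some i)))))
       /\<^sub>R (exp lam + 1 + 2 * real CARD('d))"

lemma coord_inject: "coord z = coord w \<longleftrightarrow> z = w"
  by (auto simp: fun_eq_iff coord_def vec_eq_iff prod_eq_iff split: option.splits)

lemma site_char_add: "site_char \<theta> (z + w) = site_char \<theta> z * site_char \<theta> w"
proof -
  have "coord (z + w) j = coord z j + coord w j" for j
    by (cases j) (auto simp: coord_def)
  then show ?thesis
    by (simp add: site_char_def cis_mult distrib_left prod.distrib[symmetric])
qed

lemma site_char_vertical:
  fixes \<theta> :: "'d::finite option \<Rightarrow> real"
  shows "site_char \<theta> (n, 0) = cis (\<theta> None * n)"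
proof -
  have "site_char \<theta> (n, 0) = (\<Prod>j\<in>(UNIV :: 'd option set). if j = None then cis (\<theta> None * n) else 1)"
    unfolding site_char_def by (rule prod.cong) (auto simp: coord_def split: option.splits)
  then show ?thesis by simp
qed

lemma site_char_horizontal:
  fixes \<theta> :: "'d::finite option \<Rightarrow> real"
  shows "site_char \<theta> (0, axis i s) = cis (\<theta> (Some i) * s)"
proof -
  have "site_char \<theta> (0, axis i s) = (\<Prod>j\<in>(UNIV :: 'd option set). if j = Some i then cis (\<theta> (Some i) * s) else 1)"
    unfolding site_char_def by (rule prod.cong) (auto simp: coord_def axis_def split: option.splits)
  then show ?thesis by simp
qed

text \<open>Increments are homogeneous and characters multiplicative, so each character is an
  eigenfunction of the transition operator.\<close>

lemma expectation_char_step: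
  "measure_pmf.expectation (network_step lam z) (site_char \<theta>) = step_char lam \<theta> * site_char \<theta> z"
proof -
  have "(fst z + 1, snd z) = z + (1, 0)" "(fst z - 1, snd z) = z + (-1, 0)"
    "hstep z i s = z + (0, axis i s)" for i s
    by (auto simp: hstep_def prod_eq_iff)
  moreover have "cis t + cis (- t) = of_real (2 * cos t)" for t
    by (simp add: complex_eq_iff)
  ultimately show ?thesis
    by (simp add: expectation_network_step step_char_def site_char_add site_char_vertical site_char_horizontal
        distrib_left[symmetric] sum_distrib_left[symmetric] algebra_simps scaleR_conv_of_real)
qed

lemma expectation_char_walk:
  "measure_pmf.expectation (network_walk lam 0 m) (site_char \<theta>) = step_char lam \<theta> ^ m"
proof (induction m)
  case 0
  have "coord (0 :: 'a site) j = 0" for j by (cases j) (simp_all add: coord_def)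
  then show ?case by (simp add: site_char_def)
next
  case (Suc m)
  then show ?case by (simp only: expectation_network_walk_Suc expectation_char_step) simp
qed

text \<open>By the half-angle formula, \<open>1 - cos t\<close> is twice the square of
  \<open>sin (t / 2)\<close>, and the Taylor bound gives \<open>sin u \<ge> u / 2\<close> for u up
  to pi/2.\<close>

lemma one_minus_cos_ge:
  assumes "\<bar>t\<bar> \<le> pi" shows "1 - cos t \<ge> t\<^sup>2 / 8"
proof -
  have *: "1 - cos t \<ge> t\<^sup>2 / 8" if t: "0 \<le> t" "t \<le> pi" for t :: real
  proof -
    define u where "u = t / 2"
    \<comment> \<open>8/5 lies just above pi/2, and its square 64/25 is below 3, which keeps the
      cubic term below \<open>u / 2\<close>.\<close>
    have u: "0 \<le> u" "u \<le> 8/5" using t pi_less_4 pi_approx by (auto simp: u_def)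
    have "\<bar>sin u - (\<Sum>m<3. sin_coeff m * u ^ m)\<bar> \<le> inverse (fact 3) * \<bar>u\<bar> ^ 3"
      by (rule Maclaurin_sin_bound)
    then have "\<bar>sin u - u\<bar> \<le> u ^ 3 / 6"
      using u by (simp add: sin_coeff_def lessThan_nat_numeral fact_numeral)
    then have "sin u \<ge> u - u ^ 3 / 6" by linarith
    moreover have "u\<^sup>2 \<le> (8/5)\<^sup>2" using u by (intro power_mono) auto
    then have "u * u\<^sup>2 \<le> u * (64/25)" using u by (intro mult_left_mono) (auto simp: power2_eq_square)
    then have "u - u ^ 3 / 6 \<ge> u / 2" using u by (simp add: power3_eq_cube power2_eq_square)
    ultimately have "sin u \<ge> u / 2" by linarith
    then have "(sin u)\<^sup>2 \<ge> (u / 2)\<^sup>2" using u by (intro power_mono) auto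
    moreover have "cos t = 1 - 2 * (sin u)\<^sup>2"
      using cos_double_sin[of u] by (simp add: u_def)
    ultimately show ?thesis by (simp add: u_def power2_eq_square field_simps)
  qed
  show ?thesis
  proof (cases "t \<ge> 0")
    case True then show ?thesis using *[of t] assms by simp
  next
    case False then show ?thesis using *[of "-t"] assms by simp
  qed
qed

text \<open>After clearing the denominator, the real part is \<open>A + B\<close> with both terms
  nonnegative: \<open>B\<close> controls the horizontal frequencies, while \<open>A\<close> and the
  imaginary part, which comes from the drift, control the vertical one. The set \<open>S\<close>
  allows keeping just three horizontal frequencies in any higher dimension.\<close>

lemma norm_one_minus_step_char_ge:
  fixes \<theta> :: "'d::finite option \<Rightarrow> real"
  assumes "\<And>j. \<bar>\<theta> j\<bar> \<le> pi" and S: "S \<subseteq> (UNIV :: 'd set)"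
  shows "((exp lam + 1 + 2 * real CARD('d)) * norm (1 - step_char lam \<theta>))\<^sup>2
     \<ge> min 1 ((exp lam - 1)\<^sup>2) / 16 * ((\<theta> None)\<^sup>2 + (\<Sum>i\<in>S. (\<theta> (Some i)) ^ 4))"
proof -
  let ?D = "exp lam + 1 + 2 * real CARD('d)" and ?\<kappa> = "min 1 ((exp lam - 1)\<^sup>2)"
  let ?s = "\<theta> None" and ?c = "\<lambda>i. 1 - cos (\<theta> (Some i))"
  have D: "?D > 0" by (simp add: add_pos_nonneg)
  define A where "A = (exp lam + 1) * (1 - cos ?s)"
  define B where "B = (\<Sum>i\<in>UNIV. 2 * ?c i)"
  have "?D *\<^sub>R (1 - step_char lam \<theta>) = Complex (A + B) (- ((exp lam - 1) * sin ?s))"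
  proof -
    have "?D *\<^sub>R step_char lam \<theta>
        = exp lam *\<^sub>R cis ?s + (cis (- ?s) + of_real (\<Sum>i\<in>UNIV. 2 * cos (\<theta> (Some i))))"
      using D by (simp add: step_char_def del: of_real_sum)
    then show ?thesis
      by (simp add: scaleR_diff_right complex_eq_iff A_def B_def sum_subtractf sum_distrib_left algebra_simps del: of_real_sum)
  qed
  then have "(norm (?D *\<^sub>R (1 - step_char lam \<theta>)))\<^sup>2 = (A + B)\<^sup>2 + ((exp lam - 1) * sin ?s)\<^sup>2"
    by (simp only: cmod_power2 complex.sel power2_minus)
  then have "(?D * norm (1 - step_char lam \<theta>))\<^sup>2 = (A + B)\<^sup>2 + ((exp lam - 1) * sin ?s)\<^sup>2"
    using D by (simp only: norm_scaleR abs_of_pos)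
  moreover have "A \<ge> 1 - cos ?s"
    unfolding A_def by (simp add: distrib_right)
  then have A2: "A \<ge> 0" "A\<^sup>2 \<ge> (1 - cos ?s)\<^sup>2" by (auto intro!: power_mono order_trans[OF _ \<open>A \<ge> _\<close>])
  have c: "?c i \<ge> (\<theta> (Some i))\<^sup>2 / 8" for i
    by (intro one_minus_cos_ge assms)
  have cn: "?c i \<ge> 0" for i by simp
  have "(\<Sum>i\<in>S. (\<theta> (Some i)) ^ 4 / 16) \<le> B\<^sup>2"
  proof -
    have fS: "finite S" by (rule finite_subset[OF S]) simp
    have "(\<Sum>i\<in>S. (\<theta> (Some i)) ^ 4 / 16) \<le> (\<Sum>i\<in>S. (2 * ?c i)\<^sup>2)"
    proof (rule sum_mono)
      fix i
      have "((\<theta> (Some i))\<^sup>2 / 8)\<^sup>2 \<le> (?c i)\<^sup>2" using c[of i] by (intro power_mono) auto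
      then show "(\<theta> (Some i)) ^ 4 / 16 \<le> (2 * ?c i)\<^sup>2"
        by (simp only: power_mult_distrib power_divide) simp
    qed
    also have "\<dots> \<le> (\<Sum>i\<in>S. 2 * ?c i)\<^sup>2"
      by (intro sum_power2_le_power2_sum)  simp
    also have "\<dots> \<le> B\<^sup>2" unfolding B_def
      by (intro power_mono sum_mono2 sum_nonneg S) auto
    finally show ?thesis .
  qed
  moreover have "B \<ge> 0" unfolding B_def by (intro sum_nonneg) auto
  moreover have "(A + B)\<^sup>2 \<ge> A\<^sup>2 + B\<^sup>2"
    using \<open>A \<ge> 0\<close> \<open>B \<ge> 0\<close> by (simp add: power2_sum)
  moreover have "A\<^sup>2 + ((exp lam - 1) * sin ?s)\<^sup>2 \<ge> ?\<kappa> * (?s\<^sup>2 / 4)"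
  proof -
    \<comment> \<open>The sine alone vanishes at frequency pi; together with
      \<open>1 - cos ?s\<close> it gives the squared distance from \<open>cis ?s\<close> to
      1.\<close>
    have "?s\<^sup>2 / 4 \<le> 2 * (1 - cos ?s)" using one_minus_cos_ge[OF assms(1)[of None]] by simp
    also have "\<dots> = (1 - cos ?s)\<^sup>2 + (sin ?s)\<^sup>2"
      using sin_cos_squared_add[of ?s] by (simp add: power2_eq_square algebra_simps)
    finally have "?\<kappa> * (?s\<^sup>2 / 4) \<le> ?\<kappa> * ((1 - cos ?s)\<^sup>2 + (sin ?s)\<^sup>2)"
      by (intro mult_left_mono) auto
    also have "\<dots> = ?\<kappa> * (1 - cos ?s)\<^sup>2 + ?\<kappa> * (sin ?s)\<^sup>2" by (simp add: distrib_left)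
    also have "\<dots> \<le> 1 * (1 - cos ?s)\<^sup>2 + (exp lam - 1)\<^sup>2 * (sin ?s)\<^sup>2"
      by (intro add_mono mult_right_mono) auto
    finally show ?thesis using A2(2) unfolding power_mult_distrib by linarith
  qed
  \<comment> \<open>Weakening 1/4 to 1/16 gives this term the same constant as the quartic
    terms.\<close>
  moreover have "?\<kappa> * (?s\<^sup>2 / 16) \<le> ?\<kappa> * (?s\<^sup>2 / 4)"
    by (intro mult_left_mono) auto
  moreover have "?\<kappa> * (\<Sum>i\<in>S. (\<theta> (Some i)) ^ 4 / 16) \<le> 1 * (\<Sum>i\<in>S. (\<theta> (Some i)) ^ 4 / 16)"
    by (intro mult_right_mono sum_nonneg) auto
  moreover have "?\<kappa> / 16 * (?s\<^sup>2 + (\<Sum>i\<in>S. (\<theta> (Some i)) ^ 4))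
      = ?\<kappa> * (?s\<^sup>2 / 16) + ?\<kappa> * (\<Sum>i\<in>S. (\<theta> (Some i)) ^ 4 / 16)"
    by (simp add: sum_divide_distrib[symmetric] distrib_left)
  ultimately show ?thesis by linarith
qed

section \<open>Parseval on the torus\<close>

definition angles :: "real measure" where
  "angles = restrict_space lborel {-pi..pi}"

text \<open>The measure is not normalised, hence the factor \<open>(2 * pi) ^ Suc CARD('d)\<close>
  in \<open>parseval\<close>.\<close>

definition torus :: "('d::finite option \<Rightarrow> real) measure" where
  "torus = PiM UNIV (\<lambda>_. angles)"

lemma space_angles: "space angles = {-pi..pi}"
  by (simp add: angles_def space_restrict_space)

lemma finite_measure_angles: "finite_measure angles"
  by (rule finite_measureI) (simp add: angles_def space_restrict_space emeasure_restrict_space)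

lemma borel_measurable_angles: "f \<in> borel_measurable borel \<Longrightarrow> f \<in> borel_measurable angles"
  unfolding angles_def by (rule measurable_restrict_space1) simp

interpretation torus: product_sigma_finite "\<lambda>_. angles"
  by (rule product_sigma_finite.intro) (rule finite_measure.axioms(1)[OF finite_measure_angles])

lemma integral_cis_angles:
  "(\<integral>t. cis (t * of_int k) \<partial>angles) = (if k = 0 then 2 * of_real pi else 0)"
proof (cases "k = 0")
  case True
  then show ?thesis
    by (simp add: angles_def measure_restrict_space space_restrict_space scaleR_conv_of_real)
next
  case False
  define F where "F t = cis (t * of_int k) / (\<i> * of_int k)" for t :: real
  have "(F has_vector_derivative cis (t * of_int k)) (at t within A)" for t A
    unfolding F_def cis_conv_exp using False
    by (auto intro!: derivative_eq_intros has_vector_derivative_real_field simp: field_simps)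
  then have "(\<integral>t. indicator {-pi..pi} t *\<^sub>R cis (t * of_int k) \<partial>lborel) = F pi - F (-pi)"
    by (intro integral_FTC_Icc continuous_intros) auto
  also have "cis (pi * of_int k) = cis (- pi * of_int k)"
    by (simp add: complex_eq_iff)
  then have "F pi - F (-pi) = 0" by (simp add: F_def)
  finally show ?thesis
    using False by (simp add: angles_def integral_restrict_space)
qed

lemma integrable_cis_angles: "integrable angles (\<lambda>t. cis (t * of_int k))"
proof -
  have "(\<lambda>t. cis (t * of_int k)) \<in> borel_measurable borel"
    unfolding cis_conv_exp by (intro borel_measurable_continuous_onI continuous_intros)
  then show ?thesis
    by (intro finite_measure.integrable_const_bound[OF finite_measure_angles, where B=1])
       (auto intro: borel_measurable_angles)
qed

lemma site_char_mult_cnj: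
  "site_char \<theta> z * cnj (site_char \<theta> w) = (\<Prod>j\<in>UNIV. cis (\<theta> j * of_int (coord z j - coord w j)))"
  by (simp add: site_char_def cis_cnj cis_mult prod.distrib[symmetric] right_diff_distrib)

lemma integrable_site_char_mult_cnj: "integrable torus (\<lambda>\<theta>. site_char \<theta> z * cnj (site_char \<theta> w))"
  unfolding site_char_mult_cnj torus_def
  by (rule torus.product_integrable_prod) (auto simp only: finite intro: integrable_cis_angles)

lemma integral_site_char_mult_cnj:
  fixes z w :: "'d::finite site"
  shows "(\<integral>\<theta>. site_char \<theta> z * cnj (site_char \<theta> w) \<partial>torus)
    = (if z = w then (2 * of_real pi) ^ Suc CARD('d) else 0)"
proof -
  have "(\<integral>\<theta>. site_char \<theta> z * cnj (site_char \<theta> w) \<partial>torus)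
      = (\<Prod>j\<in>UNIV. \<integral>t. cis (t * of_int (coord z j - coord w j)) \<partial>angles)"
    unfolding site_char_mult_cnj torus_def
    by (rule torus.product_integral_prod) (auto simp only: finite intro: integrable_cis_angles)
  also have "\<dots> = (\<Prod>j\<in>UNIV. if coord z j = coord w j then 2 * of_real pi else 0)"
    unfolding integral_cis_angles by (rule prod.cong) auto
  also have "\<dots> = (if z = w then (2 * of_real pi) ^ Suc CARD('d) else 0)"
  proof (cases "z = w")
    case False
    then obtain j where "coord z j \<noteq> coord w j" using coord_inject by blast
    then show ?thesis using False by (subst prod_zero) auto
  qed simp
  finally show ?thesis .
qed

text \<open>For a finite set the squared norm expands into a finite double sum, of which
  orthogonality of characters leaves only the diagonal.\<close>

lemma parseval:
  fixes A :: "'d::finite site set" and g :: "'d site \<Rightarrow> real"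
  assumes "finite A"
  shows "(\<integral>\<^sup>+\<theta>. ennreal ((norm (\<Sum>z\<in>A. g z *\<^sub>R site_char \<theta> z))\<^sup>2) \<partial>torus)
    = ennreal ((2 * pi) ^ Suc CARD('d) * (\<Sum>z\<in>A. (g z)\<^sup>2))"
proof -
  let ?T = "\<lambda>\<theta>. \<Sum>z\<in>A. g z *\<^sub>R site_char \<theta> z"
  have *: "complex_of_real ((norm (?T \<theta>))\<^sup>2)
      = (\<Sum>z\<in>A. \<Sum>w\<in>A. of_real (g z * g w) * (site_char \<theta> z * cnj (site_char \<theta> w)))" for \<theta>
    by (simp add: complex_norm_square sum_product scaleR_conv_of_real mult_ac del: of_real_power)
  have int: "integrable torus (\<lambda>\<theta>. complex_of_real ((norm (?T \<theta>))\<^sup>2))"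
    unfolding * by (intro Bochner_Integration.integrable_sum integrable_mult_right integrable_site_char_mult_cnj)
  have "(\<integral>\<theta>. complex_of_real ((norm (?T \<theta>))\<^sup>2) \<partial>torus)
      = (\<Sum>z\<in>A. \<Sum>w\<in>A. of_real (g z * g w) * (if z = w then (2 * of_real pi) ^ Suc CARD('d) else 0))"
    unfolding *
    by (simp add: Bochner_Integration.integral_sum integrable_site_char_mult_cnj integral_site_char_mult_cnj
        Bochner_Integration.integrable_sum del: power_Suc)
  also have "\<dots> = of_real ((2 * pi) ^ Suc CARD('d) * (\<Sum>z\<in>A. (g z)\<^sup>2))"
    using assms by (simp add: if_distrib sum_distrib_left power2_eq_square mult_ac cong: if_cong)
  finally have "(\<integral>\<theta>. (norm (?T \<theta>))\<^sup>2 \<partial>torus) = (2 * pi) ^ Suc CARD('d) * (\<Sum>z\<in>A. (g z)\<^sup>2)"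
    by (simp only: integral_complex_of_real of_real_eq_iff)
  then show ?thesis
    using int by (subst nn_integral_eq_integral) (simp_all only: complex_of_real_integrable_eq, auto)
qed

text \<open>The exponent 4/5 is below 1, so the singularity at 0 is integrable.\<close>

lemma nn_integral_powr_angles: "(\<integral>\<^sup>+t. inverse (ennreal (\<bar>t\<bar> powr (4/5))) \<partial>angles) < \<infinity>"
proof -
  \<comment> \<open>The integral of the -4/5 power of t from 0 to pi.\<close>
  define c where "c = pi powr (1/5) * 5"
  have 1: "((\<lambda>t. \<bar>t\<bar> powr (-4/5)) has_integral c) {0..pi}"
    using has_integral_powr_from_0[of "-4/5" pi]
    by (rule_tac has_integral_eq[of _ "\<lambda>t. t powr (-4/5)"]) (auto simp: c_def)
  have 2: "((\<lambda>t. \<bar>t\<bar> powr (-4/5)) has_integral c) {-pi..0}"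
    using iffD2[OF has_integral_reflect_real 1] by simp
  have "((\<lambda>t. \<bar>t\<bar> powr (-4/5)) has_integral (c + c)) {-pi..pi}"
    by (rule has_integral_combine[OF _ _ 2 1]) auto
  then have "((\<lambda>t. if t \<in> {-pi..pi} then \<bar>t\<bar> powr (-4/5) else 0) has_integral (c + c)) UNIV"
    by (simp only: has_integral_restrict_UNIV)
  then have "integral\<^sup>N lborel (\<lambda>t. ennreal (if t \<in> {-pi..pi} then \<bar>t\<bar> powr (-4/5) else 0)) = ennreal (c + c)"
    by (intro nn_integral_has_integral_lborel) auto
  moreover have "(\<integral>\<^sup>+t. inverse (ennreal (\<bar>t\<bar> powr (4/5))) \<partial>angles)
      = (\<integral>\<^sup>+t. ennreal (if t \<in> {-pi..pi} then \<bar>t\<bar> powr (-4/5) else 0) \<partial>lborel)"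
    unfolding angles_def
  proof (subst nn_integral_restrict_space, simp, rule nn_integral_cong_AE)
    \<comment> \<open>The integrands differ only at 0, where the left one is \<open>top\<close> and
      the real power is 0.\<close>
    show "AE t in lborel. inverse (ennreal (\<bar>t\<bar> powr (4/5))) * indicator {-pi..pi} t
        = ennreal (if t \<in> {-pi..pi} then \<bar>t\<bar> powr (-4/5) else 0)"
      using AE_lborel_singleton[of 0]
      by eventually_elim (auto simp: inverse_ennreal powr_minus split: split_indicator)
  qed
  ultimately show ?thesis by simp
qed

section \<open>Summability for three or more horizontal dimensions\<close>

lemma norm_site_char [simp]: "norm (site_char \<theta> z) = 1"
  by (simp add: site_char_def prod_norm[symmetric])

text \<open>The power is an expectation of numbers of modulus 1.\<close>

lemma norm_step_char_power_le: "norm (step_char lam \<theta> ^ m) \<le> 1"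
proof -
  have "norm (step_char lam \<theta> ^ m) \<le> measure_pmf.expectation (network_walk lam 0 m) (\<lambda>z. norm (site_char \<theta> z))"
    unfolding expectation_char_walk[symmetric] by (rule integral_norm_bound)
  then show ?thesis by simp
qed

text \<open>The other factors are inverses of finite numbers, hence nonzero, so none of them can
  absorb the infinite factor.\<close>

lemma ennreal_prod_inverse_top:
  fixes x :: "'a \<Rightarrow> real"
  assumes "finite J" "j \<in> J" "x j = 0"
  shows "(\<Prod>i\<in>J. inverse (ennreal (x i))) = top"
proof -
  have "(\<Prod>i\<in>J. inverse (ennreal (x i))) = inverse (ennreal (x j)) * (\<Prod>i\<in>J-{j}. inverse (ennreal (x i)))"
    using assms by (intro prod.remove)
  moreover have "(\<Prod>i\<in>J-{j}. inverse (ennreal (x i))) \<noteq> 0"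
    using \<open>finite J\<close> by (simp add: prod_zero_iff)
  ultimately show ?thesis using assms by (simp add: ennreal_top_mult)
qed

text \<open>
  In \<open>ennreal\<close> the inverse of 0 is \<open>top\<close>, so frequencies with a vanishing coordinate need no exclusion.
\<close>

lemma geometric_step_char_bound:
  fixes \<theta> :: "'d::finite option \<Rightarrow> real" and S :: "'d set"
  assumes lam: "lam > 0" and \<theta>: "\<And>j. \<bar>\<theta> j\<bar> \<le> pi" and S: "card S = 3"
  defines "C \<equiv> 64 * (exp lam + 1 + 2 * real CARD('d))\<^sup>2 / min 1 ((exp lam - 1)\<^sup>2)"
  shows "ennreal ((norm (\<Sum>m<M. step_char lam \<theta> ^ m))\<^sup>2)
    \<le> ennreal C * (\<Prod>j\<in>insert None (Some ` S). inverse (ennreal (\<bar>\<theta> j\<bar> powr (4/5))))"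
proof -
  let ?D = "exp lam + 1 + 2 * real CARD('d)" and ?\<kappa> = "min 1 ((exp lam - 1)\<^sup>2)"
  have D: "?D > 0" by (simp add: add_pos_nonneg)
  have \<kappa>: "?\<kappa> > 0" using lam by simp
  have C: "C > 0" unfolding C_def using D \<kappa> by (intro divide_pos_pos mult_pos_pos) auto
  show ?thesis
  proof (cases "\<exists>j\<in>insert None (Some ` S). \<theta> j = 0")
    case True
    then have "(\<Prod>j\<in>insert None (Some ` S). inverse (ennreal (\<bar>\<theta> j\<bar> powr (4/5)))) = top"
      by (elim bexE) (rule ennreal_prod_inverse_top, auto)
    then show ?thesis using C by (simp add: ennreal_mult_top)
  next
    case False
    define Q where "Q = (\<theta> None)\<^sup>2 + (\<Sum>i\<in>S. (\<theta> (Some i)) ^ 4)"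
    have Q: "Q > 0" unfolding Q_def using False by (intro add_pos_nonneg sum_nonneg) auto
    define R where "R = (\<Prod>j\<in>insert None (Some ` S). \<bar>\<theta> j\<bar> powr (4/5))"
    have R: "R > 0" unfolding R_def using False by (intro prod_pos) auto
    have "\<bar>\<theta> None\<bar> powr (4/5) = (\<bar>\<theta> None\<bar> powr 2) powr (2/5)" by (simp only: powr_powr) simp
    also have "\<dots> \<le> Q powr (2/5)"
      by (intro powr_mono2) (auto simp: Q_def intro!: sum_nonneg)
    finally have R0: "\<bar>\<theta> None\<bar> powr (4/5) \<le> Q powr (2/5)" .
    have Ri: "\<bar>\<theta> (Some i)\<bar> powr (4/5) \<le> Q powr (1/5)" if "i \<in> S" for i
    proof -
      have "(\<theta> (Some i)) ^ 4 \<le> (\<Sum>i\<in>S. (\<theta> (Some i)) ^ 4)"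
        using that by (intro member_le_sum) auto
      then have "\<bar>\<theta> (Some i)\<bar> powr 4 \<le> Q" by (simp add: Q_def add_increasing)
      then have "(\<bar>\<theta> (Some i)\<bar> powr 4) powr (1/5) \<le> Q powr (1/5)"
        by (intro powr_mono2) auto
      then show ?thesis unfolding powr_powr by simp
    qed
    have "R = \<bar>\<theta> None\<bar> powr (4/5) * (\<Prod>i\<in>S. \<bar>\<theta> (Some i)\<bar> powr (4/5))"
      unfolding R_def by (subst prod.insert) (auto simp: prod.reindex)
    also have "\<dots> \<le> Q powr (2/5) * (\<Prod>i\<in>S. Q powr (1/5))"
      by (intro mult_mono R0 prod_mono) (auto intro: Ri prod_nonneg)
    also have "(\<Prod>i\<in>S. Q powr (1/5)) = Q powr (3/5)"
      using Q by (simp add: S powr_power)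
    also have "Q powr (2/5) * Q powr (3/5) = Q"
      using Q by (simp add: powr_add[symmetric])
    finally have RQ: "R \<le> Q" .
    let ?N = "norm (1 - step_char lam \<theta>)"
    have N: "(?D * ?N)\<^sup>2 \<ge> ?\<kappa> / 16 * Q"
      unfolding Q_def by (rule norm_one_minus_step_char_ge[OF \<theta>]) auto
    then have DN: "(?D * ?N)\<^sup>2 > 0" using Q \<kappa> by (smt (verit) divide_pos_pos mult_pos_pos)
    then have N0: "?N > 0" by auto
    have \<kappa>Q: "?\<kappa> / 16 * Q > 0" using Q \<kappa> by (intro mult_pos_pos divide_pos_pos) auto
    \<comment> \<open>Bounding the numerator of the geometric sum by 2 makes the estimate uniform in
      \<open>M\<close>. Its square 4 and the 1/16 in \<open>N\<close> produce the 64 in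
      \<open>C\<close>.\<close>
    have "norm (\<Sum>m<M. step_char lam \<theta> ^ m) = norm (1 - step_char lam \<theta> ^ M) / ?N"
      using N0 by (subst sum_gp_strict) (auto simp: norm_divide)
    also have "\<dots> \<le> 2 / ?N"
      using norm_triangle_ineq4[of 1 "step_char lam \<theta> ^ M"] norm_step_char_power_le[of lam \<theta> M] N0
      by (intro divide_right_mono) auto
    finally have "(norm (\<Sum>m<M. step_char lam \<theta> ^ m))\<^sup>2 \<le> (2 / ?N)\<^sup>2"
      by (intro power_mono) auto
    also have "\<dots> = 4 * ?D\<^sup>2 / (?D * ?N)\<^sup>2"
      using D N0 by (simp add: power_divide power_mult_distrib)
    also have "\<dots> \<le> 4 * ?D\<^sup>2 / (?\<kappa> / 16 * Q)"
      by (rule divide_left_mono[OF N _ mult_pos_pos[OF DN \<kappa>Q]]) simp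
    also have "\<dots> = C / Q" by (simp add: C_def)
    also have "\<dots> \<le> C / R" using RQ R Q C by (intro divide_left_mono) auto
    finally have "(norm (\<Sum>m<M. step_char lam \<theta> ^ m))\<^sup>2 \<le> C / R" .
    then have "ennreal ((norm (\<Sum>m<M. step_char lam \<theta> ^ m))\<^sup>2) \<le> ennreal (C * inverse R)"
      by (simp add: ennreal_leI divide_inverse)
    also have "\<dots> = ennreal C * ennreal (inverse R)"
      using C by (simp add: ennreal_mult')
    also have "inverse R = (\<Prod>j\<in>insert None (Some ` S). inverse (\<bar>\<theta> j\<bar> powr (4/5)))"
      by (simp only: R_def prod_inversef[symmetric] comp_def)
    also have "ennreal (\<Prod>j\<in>insert None (Some ` S). inverse (\<bar>\<theta> j\<bar> powr (4/5)))
        = (\<Prod>j\<in>insert None (Some ` S). inverse (ennreal (\<bar>\<theta> j\<bar> powr (4/5))))"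
      using False by (subst prod_ennreal[symmetric], simp, intro prod.cong refl) (auto simp: inverse_ennreal)
    finally show ?thesis .
  qed
qed

text \<open>Truncating time at \<open>M\<close> and space to \<open>A\<close> keeps every sum
  finite; that \<open>K\<close> depends on neither allows both limits to be taken
  afterwards.\<close>

lemma sum_power2_walk_bound:
  fixes lam :: real
  assumes lam: "lam > 0" and d: "CARD('d::finite) \<ge> 3"
  obtains K where "K \<ge> 0"
    "\<And>A M. finite A \<Longrightarrow> (\<Sum>z\<in>A. (\<Sum>m<M. pmf (network_walk lam (0 :: 'd site) m) z)\<^sup>2) \<le> K"
proof -
  obtain S :: "'d set" where S: "card S = 3"
    using obtain_subset_with_card_n[OF d] by blast
  let ?J = "insert None (Some ` S)"
  \<comment> \<open>Padding with factors 1 turns the product over \<open>?J\<close> into one over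
    all coordinates, as integration over the product measure requires.\<close>
  let ?h = "\<lambda>j t. if j \<in> ?J then inverse (ennreal (\<bar>t\<bar> powr (4/5))) else 1"
  define C where "C = 64 * (exp lam + 1 + 2 * real CARD('d))\<^sup>2 / min 1 ((exp lam - 1)\<^sup>2)"
  define B where "B = (\<integral>\<^sup>+\<theta>. ennreal C * (\<Prod>j\<in>UNIV. ?h j (\<theta> j)) \<partial>(torus :: ('d option \<Rightarrow> real) measure))"
  have h: "?h j \<in> borel_measurable angles" for j
    by (rule borel_measurable_angles) simp
  have "(\<lambda>\<theta>. \<Prod>j\<in>UNIV. ?h j (\<theta> j)) \<in> borel_measurable torus"
    unfolding torus_def using h by measurable
  then have "B = ennreal C * (\<integral>\<^sup>+\<theta>. (\<Prod>j\<in>UNIV. ?h j (\<theta> j)) \<partial>torus)"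
    unfolding B_def by (rule nn_integral_cmult)
  also have "(\<integral>\<^sup>+\<theta>. (\<Prod>j\<in>UNIV. ?h j (\<theta> j)) \<partial>torus) = (\<Prod>j\<in>UNIV. \<integral>\<^sup>+t. ?h j t \<partial>angles)"
    unfolding torus_def by (rule torus.product_nn_integral_prod) (use h in auto)
  finally have B_eq: "B = ennreal C * (\<Prod>j\<in>UNIV. \<integral>\<^sup>+t. ?h j t \<partial>angles)" .
  have h_fin: "(\<integral>\<^sup>+t. ?h j t \<partial>angles) \<noteq> top" for j
  proof (cases "j \<in> ?J")
    case True
    then show ?thesis using nn_integral_powr_angles by simp
  next
    case False
    then show ?thesis
      using finite_measure.emeasure_finite[OF finite_measure_angles] by (simp only: if_False nn_integral_const) (simp add: less_top)
  qed
  have B: "B < top"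
    unfolding B_eq less_top[symmetric] using h_fin
    by (simp only: ennreal_mult_eq_top_iff ennreal_prod_eq_top) simp
  have bound: "(\<Sum>z\<in>A. (\<Sum>m<M. pmf (network_walk lam (0 :: 'd site) m) z)\<^sup>2) \<le> enn2real B"
    if A: "finite A" for A M
  proof -
    let ?P = "\<lambda>m. network_walk lam (0 :: 'd site) m"
    \<comment> \<open>Once all supports up to time \<open>M\<close> are included, the trigonometric
      sum equals the geometric sum exactly.\<close>
    define A' where "A' = A \<union> (\<Union>m<M. set_pmf (?P m))"
    have A': "finite A'" by (auto simp: A'_def A finite_set_pmf_network_walk)
    let ?g = "\<lambda>z. \<Sum>m<M. pmf (?P m) z"
    have "(\<Sum>z\<in>A'. ?g z *\<^sub>R site_char \<theta> z) = (\<Sum>m<M. step_char lam \<theta> ^ m)" for \<theta>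
    proof -
      have "step_char lam \<theta> ^ m = (\<Sum>z\<in>A'. pmf (?P m) z *\<^sub>R site_char \<theta> z)" if "m < M" for m
        unfolding expectation_char_walk[symmetric]
        by (rule integral_measure_pmf[OF A']) (use that in \<open>auto simp: A'_def\<close>)
      then have "(\<Sum>m<M. step_char lam \<theta> ^ m) = (\<Sum>m<M. \<Sum>z\<in>A'. pmf (?P m) z *\<^sub>R site_char \<theta> z)"
        by (intro sum.cong) auto
      also have "\<dots> = (\<Sum>z\<in>A'. ?g z *\<^sub>R site_char \<theta> z)"
        by (subst sum.swap) (simp add: scaleR_sum_left)
      finally show ?thesis by simp
    qed
    then have "ennreal ((2 * pi) ^ Suc CARD('d) * (\<Sum>z\<in>A'. (?g z)\<^sup>2))
       = (\<integral>\<^sup>+\<theta>. ennreal ((norm (\<Sum>m<M. step_char lam \<theta> ^ m))\<^sup>2) \<partial>(torus :: ('d option \<Rightarrow> real) measure))"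
      using parseval[OF A', of ?g] by simp
    also have "\<dots> \<le> B"
      unfolding B_def
    proof (rule nn_integral_mono)
      fix \<theta> :: "'d option \<Rightarrow> real" assume "\<theta> \<in> space torus"
      then have "\<theta> j \<in> {-pi..pi}" for j
        by (auto simp: torus_def space_PiM space_angles PiE_UNIV_domain Pi_iff)
      then have \<theta>: "\<bar>\<theta> j\<bar> \<le> pi" for j by (simp add: abs_le_iff minus_le_iff)
      have "(\<Prod>j\<in>UNIV. ?h j (\<theta> j)) = (\<Prod>j\<in>?J. inverse (ennreal (\<bar>\<theta> j\<bar> powr (4/5))))"
        by (simp only: prod.If_cases finite Collect_mem_eq Int_UNIV_left prod.neutral_const mult_1_right)
      then show "ennreal ((norm (\<Sum>m<M. step_char lam \<theta> ^ m))\<^sup>2) \<le> ennreal C * (\<Prod>j\<in>UNIV. ?h j (\<theta> j))"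
        using geometric_step_char_bound[OF lam \<theta> S, where M=M] by (simp add: C_def)
    qed
    finally have "enn2real (ennreal ((2 * pi) ^ Suc CARD('d) * (\<Sum>z\<in>A'. (?g z)\<^sup>2))) \<le> enn2real B"
      using B by (rule enn2real_mono)
    then have "(2 * pi) ^ Suc CARD('d) * (\<Sum>z\<in>A'. (?g z)\<^sup>2) \<le> enn2real B"
      by (subst (asm) enn2real_ennreal) (intro mult_nonneg_nonneg sum_nonneg zero_le_power, auto)
    moreover have "1 * (\<Sum>z\<in>A'. (?g z)\<^sup>2) \<le> (2 * pi) ^ Suc CARD('d) * (\<Sum>z\<in>A'. (?g z)\<^sup>2)"
      using pi_gt3 by (intro mult_right_mono one_le_power sum_nonneg) auto
    moreover have "(\<Sum>z\<in>A. (?g z)\<^sup>2) \<le> (\<Sum>z\<in>A'. (?g z)\<^sup>2)"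
      by (intro sum_mono2 A') (auto simp: A'_def)
    ultimately show ?thesis by linarith
  qed
  show thesis by (rule that[OF enn2real_nonneg bound])
qed

text \<open>Singletons in the uniform bound show that \<open>green\<close> is finite at each site.
  Then \<open>M\<close> tends to infinity for fixed \<open>A\<close>, and finally the supremum over
  finite \<open>A\<close> is taken.\<close>

lemma infsum_green_power2_finite:
  fixes lam :: real
  assumes lam: "lam > 0" and d: "CARD('d::finite) \<ge> 3"
  shows "(\<Sum>\<^sub>\<infinity>z\<in>(UNIV :: 'd site set). (green lam 0 z)\<^sup>2) < \<infinity>"
proof -
  let ?p = "\<lambda>z m. pmf (network_walk lam (0 :: 'd site) m) z"
  obtain K where K: "K \<ge> 0" "\<And>A M. finite A \<Longrightarrow> (\<Sum>z\<in>A. (\<Sum>m<M. ?p z m)\<^sup>2) \<le> K"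
    using sum_power2_walk_bound[OF lam d] by metis
  have summable: "summable (?p z)" for z
  proof (rule summableI_nonneg_bounded)
    show "(\<Sum>m<M. ?p z m) \<le> sqrt K" for M
      using K(2)[of "{z}" M] by (intro real_le_rsqrt) simp
  qed simp
  then have green_eq: "green lam 0 z = ennreal (\<Sum>m. ?p z m)" for z
    unfolding green_def by (intro suminf_ennreal2) auto
  have "(\<Sum>z\<in>A. (green lam 0 z)\<^sup>2) \<le> ennreal K" if A: "finite A" for A :: "'d site set"
  proof -
    have "(\<lambda>M. \<Sum>z\<in>A. (\<Sum>m<M. ?p z m)\<^sup>2) \<longlonglongrightarrow> (\<Sum>z\<in>A. (\<Sum>m. ?p z m)\<^sup>2)"
      by (intro tendsto_intros summable_LIMSEQ summable)
    then have "(\<Sum>z\<in>A. (\<Sum>m. ?p z m)\<^sup>2) \<le> K"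
      by (rule LIMSEQ_le_const2) (use K(2)[OF A] in auto)
    moreover have "(\<Sum>z\<in>A. (green lam 0 z)\<^sup>2) = ennreal (\<Sum>z\<in>A. (\<Sum>m. ?p z m)\<^sup>2)"
      unfolding green_eq by (simp add: ennreal_power suminf_nonneg[OF summable])
    ultimately show ?thesis by (simp add: ennreal_leI)
  qed
  then have "(\<Sum>\<^sub>\<infinity>z\<in>(UNIV :: 'd site set). (green lam 0 z)\<^sup>2) \<le> ennreal K"
    by (subst nonneg_infsum_complete) (auto intro!: SUP_least)
  also have "\<dots> < \<infinity>" by simp
  finally show ?thesis .
qed

section \<open>Divergence for one or two horizontal dimensions\<close>

text \<open>With N = \<open>4 ^ k\<close>, leaving the box horizontally forces
  \<open>sqn z \<ge> 4 * 4 ^ k\<close>, the threshold for the Markov bound.\<close>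

definition walk_box :: "nat \<Rightarrow> 'd::finite site set" where
  "walk_box k = {z. \<bar>fst z\<bar> \<le> 2 * 4 ^ k \<and> (\<forall>i. \<bar>snd z $ i\<bar> < 2 * 2 ^ k)}"

lemma walk_box_eq_image:
  "walk_box k = (\<lambda>(n, f). (n, vec_lambda f)) `
     ({- 2 * 4 ^ k..2 * 4 ^ k} \<times> (PiE UNIV (\<lambda>_. {- 2 * 2 ^ k<..<2 * 2 ^ k})))"
  (is "_ = ?h ` ?B")
proof
  show "walk_box k \<subseteq> ?h ` ?B"
  proof
    fix z :: "'a site" assume "z \<in> walk_box k"
    then have "(fst z, \<lambda>i. snd z $ i) \<in> ?B"
      by (auto simp: walk_box_def abs_le_iff abs_less_iff minus_le_iff minus_less_iff)
    moreover have "z = ?h (fst z, \<lambda>i. snd z $ i)" by simp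
    ultimately show "z \<in> ?h ` ?B" by (rule rev_image_eqI)
  qed
qed (auto simp: walk_box_def PiE_def Pi_def abs_le_iff abs_less_iff minus_le_iff minus_less_iff)

lemma finite_walk_box: "finite (walk_box k)"
  unfolding walk_box_eq_image by (intro finite_imageI finite_cartesian_product finite_PiE) auto

text \<open>With N = \<open>4 ^ k\<close> there are at most 5N heights and, since d is at most 2, at
  most 16N horizontal positions. The dimension enters the divergence argument here.\<close>

lemma card_walk_box:
  assumes "CARD('d::finite) \<le> 2"
  shows "real (card (walk_box k :: 'd site set)) \<le> 80 * (4 ^ k)\<^sup>2"
proof -
  have "card (walk_box k :: 'd site set)
      \<le> card ({- 2 * 4 ^ k..2 * 4 ^ k :: int} \<times> (PiE (UNIV :: 'd set) (\<lambda>_. {- 2 * 2 ^ k<..<2 * 2 ^ k :: int})))"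
    unfolding walk_box_eq_image by (intro card_image_le finite_cartesian_product finite_PiE) auto
  also have "\<dots> = nat (4 * 4 ^ k + 1) * (nat (4 * 2 ^ k - 1)) ^ CARD('d)"
    by (simp add: card_cartesian_product card_PiE)
  also have "\<dots> \<le> (5 * 4 ^ k) * (4 * 2 ^ k) ^ CARD('d)"
  proof (intro mult_mono power_mono)
    have "(1::int) \<le> 4 ^ k" by simp
    then have "4 * 4 ^ k + 1 \<le> int (5 * 4 ^ k)" by simp
    then show "nat (4 * 4 ^ k + 1) \<le> 5 * 4 ^ k" by (simp only: nat_le_iff)
  qed (simp_all add: nat_le_iff)
  also have "(4 * 2 ^ k) ^ CARD('d) \<le> (4 * 2 ^ k :: nat)\<^sup>2"
    using assms by (intro power_increasing) auto
  also have "(4 * 2 ^ k :: nat)\<^sup>2 = 16 * 4 ^ k"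
    by (simp add: power_mult_distrib power2_eq_square flip: power_mult_distrib)
  finally have "card (walk_box k :: 'd site set) \<le> 80 * (4 ^ k)\<^sup>2"
    by (simp add: power2_eq_square)
  then have "real (card (walk_box k :: 'd site set)) \<le> real (80 * (4 ^ k)\<^sup>2)"
    by (simp only: of_nat_le_iff)
  then show ?thesis by simp
qed

text \<open>The height is at most \<open>m\<close> in absolute value, so only horizontal exit is
  possible; as the mean of \<open>sqn\<close> is at most \<open>2 * 4 ^ k\<close>, Markov's
  inequality bounds its probability by 1/2.\<close>

lemma prob_walk_box:
  assumes "m \<le> 2 * 4 ^ k"
  shows "(\<Sum>z\<in>walk_box k. pmf (network_walk lam (0 :: 'd::finite site) m) z) \<ge> 1 / 2"
proof -
  let ?P = "measure_pmf.prob (network_walk lam (0 :: 'd site) m)"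
  let ?far = "{z :: 'd site. sqn z \<ge> 4 * 4 ^ k}"
  have "set_pmf (network_walk lam (0 :: 'd site) m) \<subseteq> walk_box k \<union> ?far"
  proof
    fix z assume z: "z \<in> set_pmf (network_walk lam (0 :: 'd site) m)"
    have "int m \<le> int (2 * 4 ^ k)" using assms by (simp only: of_nat_le_iff)
    then have fst: "\<bar>fst z\<bar> \<le> 2 * 4 ^ k" using abs_fst_network_walk[OF z] by simp
    show "z \<in> walk_box k \<union> ?far"
    proof (cases "z \<in> walk_box k")
      case False
      then obtain i where "2 * 2 ^ k \<le> \<bar>snd z $ i\<bar>" using fst by (auto simp: walk_box_def not_less)
      then have "real_of_int (2 * 2 ^ k) \<le> real_of_int \<bar>snd z $ i\<bar>" by (simp only: of_int_le_iff)
      then have "(2 * 2 ^ k)\<^sup>2 \<le> \<bar>real_of_int (snd z $ i)\<bar>\<^sup>2" by (intro power_mono) auto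
      moreover have "(2 * 2 ^ k)\<^sup>2 = (4 * 4 ^ k :: real)"
        by (simp add: power2_eq_square flip: power_mult_distrib)
      moreover have "(real_of_int (snd z $ i))\<^sup>2 \<le> sqn z"
        unfolding sqn_def by (rule member_le_sum) auto
      ultimately show ?thesis by simp
    qed simp
  qed
  then have "1 = ?P (walk_box k \<union> ?far)"
    by (intro measure_pmf.prob_eq_1[THEN iffD2, symmetric]) (auto simp: AE_measure_pmf_iff)
  also have "\<dots> \<le> ?P (walk_box k) + ?P ?far"
    by (rule measure_Un_le) auto
  also have "?P ?far \<le> real m / (4 * 4 ^ k)" by (rule prob_sqn_ge) simp
  also have "real m \<le> real (2 * 4 ^ k)" using assms by (simp only: of_nat_le_iff)
  then have "real m / (4 * 4 ^ k) \<le> 1 / 2" by (simp add: field_simps)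
  finally show ?thesis by (simp add: measure_measure_pmf_finite finite_walk_box)
qed

text \<open>With N = \<open>4 ^ k\<close>, the N times of the window give total mass at least N/2 in
  the box. Cauchy-Schwarz over at most 80 N^2 sites leaves (1/4)/80 = 1/320.\<close>

lemma sum_power2_block_ge:
  assumes "CARD('d::finite) \<le> 2"
  shows "(\<Sum>z\<in>walk_box k. (\<Sum>m=4^k..<2*4^k. pmf (network_walk lam (0 :: 'd site) m) z)\<^sup>2) \<ge> 1 / 320"
proof -
  let ?p = "\<lambda>m z. pmf (network_walk lam (0 :: 'd site) m) z"
  let ?b = "\<lambda>z. \<Sum>m=4^k..<2*4^k. ?p m z"
  have "4 ^ k / 2 = (\<Sum>m=4^k..<2*4^k::nat. 1 / 2 :: real)" by (simp add: of_nat_diff)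
  also have "\<dots> \<le> (\<Sum>m=4^k..<2*4^k. \<Sum>z\<in>walk_box k. ?p m z)"
    by (intro sum_mono prob_walk_box) auto
  also have "\<dots> = (\<Sum>z\<in>walk_box k. ?b z)" by (rule sum.swap)
  finally have "(4 ^ k / 2)\<^sup>2 \<le> (\<Sum>z\<in>walk_box k. ?b z)\<^sup>2" by (intro power_mono) auto
  also have "\<dots> \<le> (\<Sum>z\<in>walk_box k. (?b z)\<^sup>2) * card (walk_box k :: 'd site set)"
    by (rule sum_squared_le_sum_of_squares)
  also have "\<dots> \<le> (\<Sum>z\<in>walk_box k. (?b z)\<^sup>2) * (80 * (4 ^ k)\<^sup>2)"
    by (intro mult_left_mono card_walk_box assms sum_nonneg) auto
  finally show ?thesis by (simp add: power_divide field_simps)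
qed

text \<open>The window starting at \<open>4 ^ k\<close> ends before \<open>4 ^ Suc k\<close>, so the
  windows are disjoint; the gaps between them only add nonnegative terms.\<close>

lemma sum_dyadic_blocks_le:
  fixes f :: "nat \<Rightarrow> real"
  assumes "\<And>m. f m \<ge> 0"
  shows "(\<Sum>k<n. \<Sum>m=4^k..<2*4^k. f m) \<le> (\<Sum>m<4^n. f m)"
proof (induction n)
  case (Suc n)
  have "(\<Sum>k<Suc n. \<Sum>m=4^k..<2*4^k. f m) \<le> (\<Sum>m<4^n. f m) + (\<Sum>m=4^n..<2*4^n. f m)"
    using Suc by simp
  also have "\<dots> = (\<Sum>m<2*4^n. f m)"
    unfolding lessThan_atLeast0 by (rule sum.atLeastLessThan_concat) auto
  also have "\<dots> \<le> (\<Sum>m<4^Suc n. f m)"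
    by (intro sum_mono2) (auto simp: assms)
  finally show ?case .
qed (simp add: assms)

lemma infsum_green_power2_infinite:
  assumes d: "CARD('d::finite) \<le> 2"
  shows "(\<Sum>\<^sub>\<infinity>z\<in>(UNIV :: 'd site set). (green lam 0 z)\<^sup>2) = \<infinity>"
proof (rule ccontr)
  let ?p = "\<lambda>z m. pmf (network_walk lam (0 :: 'd site) m) z"
  let ?b = "\<lambda>k z. \<Sum>m=4^k..<2*4^k. ?p z m"
  let ?I = "\<Sum>\<^sub>\<infinity>z\<in>(UNIV :: 'd site set). (green lam 0 z)\<^sup>2"
  have b: "?b k z \<ge> 0" for k z by (intro sum_nonneg) auto
  have *: "ennreal (n / 320) \<le> ?I" for n :: nat
  proof -
    \<comment> \<open>A common finite set of sites for all \<open>n\<close> windows lets the sums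
      over windows and sites be exchanged.\<close>
    define A :: "'d site set" where "A = (\<Union>k<n. walk_box k)"
    have A: "finite A" by (simp add: A_def finite_walk_box)
    have "n / 320 = (\<Sum>k<n. 1 / 320 :: real)" by simp
    also have "\<dots> \<le> (\<Sum>k<n. \<Sum>z\<in>walk_box k. (?b k z)\<^sup>2)"
      by (intro sum_mono sum_power2_block_ge d)
    also have "\<dots> \<le> (\<Sum>k<n. \<Sum>z\<in>A. (?b k z)\<^sup>2)"
      by (intro sum_mono sum_mono2 A) (auto simp: A_def)
    also have "\<dots> = (\<Sum>z\<in>A. \<Sum>k<n. (?b k z)\<^sup>2)" by (rule sum.swap)
    also have "\<dots> \<le> (\<Sum>z\<in>A. (\<Sum>k<n. ?b k z)\<^sup>2)"
      by (intro sum_mono sum_power2_le_power2_sum b)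
    finally have "ennreal (n / 320) \<le> ennreal (\<Sum>z\<in>A. (\<Sum>k<n. ?b k z)\<^sup>2)"
      by (rule ennreal_leI)
    also have "\<dots> = (\<Sum>z\<in>A. (ennreal (\<Sum>k<n. ?b k z))\<^sup>2)"
      by (simp add: ennreal_power sum_nonneg b)
    also have "\<dots> \<le> (\<Sum>z\<in>A. (green lam 0 z)\<^sup>2)"
    proof (intro sum_mono power_mono)
      fix z
      have "ennreal (\<Sum>k<n. ?b k z) \<le> ennreal (\<Sum>m<4^n. ?p z m)"
        by (intro ennreal_leI sum_dyadic_blocks_le) simp
      also have "\<dots> = (\<Sum>m<4^n. ennreal (?p z m))" by simp
      also have "\<dots> \<le> green lam 0 z" unfolding green_def by (intro sum_le_suminf) auto
      finally show "ennreal (\<Sum>k<n. ?b k z) \<le> green lam 0 z" .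
    qed simp
    also have "\<dots> \<le> ?I"
      using A by (subst nonneg_infsum_complete) (auto intro!: SUP_upper)
    finally show ?thesis .
  qed
  assume "?I \<noteq> \<infinity>"
  then obtain r where r: "?I = ennreal r" "r \<ge> 0" by (cases ?I) auto
  obtain n :: nat where "r * 320 < n" using reals_Archimedean2 by blast
  then show False using *[of n] r by (simp add: field_simps)
qed

theorem mainTheorem4:
  fixes lam :: real
  assumes "lam > 0"
  shows "(CARD('d::finite) \<in> {1, 2} \<longrightarrow>
            (\<Sum>\<^sub>\<infinity>z\<in>(UNIV :: 'd site set). (green lam 0 z)\<^sup>2) = \<infinity>)
       \<and> (CARD('d) \<ge> 3 \<longrightarrow>
            (\<Sum>\<^sub>\<infinity>z\<in>(UNIV :: 'd site set). (green lam 0 z)\<^sup>2) < \<infinity>)"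
proof (intro conjI impI)
  assume "CARD('d) \<in> {1, 2}"
  then have "CARD('d) \<le> 2" by auto
  then show "(\<Sum>\<^sub>\<infinity>z\<in>(UNIV :: 'd site set). (green lam 0 z)\<^sup>2) = \<infinity>"
    by (rule infsum_green_power2_infinite)
next
  assume "CARD('d) \<ge> 3"
  then show "(\<Sum>\<^sub>\<infinity>z\<in>(UNIV :: 'd site set). (green lam 0 z)\<^sup>2) < \<infinity>"
    by (rule infsum_green_power2_finite[OF assms])
qed

end
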